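(* Let $k\ge 4$ be an integer. Let $G_L$ be an $\ell$-$LP_0$-snark with $\ell\ge3$ and $\sigma$ link-vertices, and let $n=|V(G_L)|=7\ell+\sigma$. Then $i_{[kR]}(G_L)\ge \left\lceil \frac{(k+1)n}{4}\right\rceil+1$.
   Context: A basic block $B_i$ has vertices $p_i,q_i,r_i,s_i,t_i,u_i,v_i$ and edges $p_it_i,t_iq_i,q_ir_i,r_is_i,s_ip_i,u_iv_i,u_ip_i,v_iq_i$. For odd $\ell\ge3$, an $\ell$-$LP_1$-snark is built from disjoint blocks $B_0,\ldots,B_{\ell-1}$: for each $i\in\{0,\ldots,\ell-1\}$ (indices modulo $\ell$) add either the pair of edges $\{s_ir_{i+1},v_iu_{i+1}\}$ or the pair $\{s_iu_{i+1},v_ir_{i+1}\}$; then choose an odd number $\sigma$ with $1\le\sigma\le\lfloor\ell/3\rfloor$ of pairwise disjoint triples $\{t_i,t_j,t_s\}$ and for each add a new vertex (link-vertex) adjacent to its three vertices; finally, the remaining $\ell-3\sigma$ vertices $t_i$ are paired up and each pair is joined by an edge (repairing edge). An $\ell$-$LP_0$-snark is an $\ell$-$LP_1$-snark in which every link-vertex is adjacent to $t_i,t_{i+1},t_{i+2}$ for some $i$ and every repairing edge is of the form $t_it_{i+1}$ (indices modulo $\ell$). For $f\colon V(G)\to\mathbb{Z}_{\ge 0}$ and $S\subseteq V(G)$, $f(S)=\sum_{v\in S}f(v)$, and $AN(v)=\{w\in N(v): f(w)\ge 1\}$. A $[k]$-Roman dominating function of $G$ is a function $f\colon V(G)\to\{0,1,\ldots,k+1\}$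 such that $f(N[v])\ge k+|AN(v)|$ for every vertex $v$ with $f(v)<k$; its weight is $f(V(G))$. $i_{[kR]}(G)$ is the minimum weight of such a function whose set of vertices with positive label is independent. *)

theory Defs
  imports Complex_Main "HOL-Library.Disjoint_Sets"
begin

text \<open>A simple graph is given by its vertex set \<open>V\<close> and its set \<open>E\<close> of edges, each edge being a
  two-element set of vertices.\<close>

definition nbhd :: "'a set \<Rightarrow> 'a set set \<Rightarrow> 'a \<Rightarrow> 'a set" where
  "nbhd V E v = {w \<in> V. w \<noteq> v \<and> {v, w} \<in> E}"

definition closed_nbhd :: "'a set \<Rightarrow> 'a set set \<Rightarrow> 'a \<Rightarrow> 'a set" where
  "closed_nbhd V E v = insert v (nbhd V E v)"

definition active_nbhd :: "'a set \<Rightarrow> 'a set set \<Rightarrow> ('a \<Rightarrow> nat) \<Rightarrow> 'a \<Rightarrow> 'a set" where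
  "active_nbhd V E f v = {w \<in> nbhd V E v. f w \<ge> 1}"

definition independent_set :: "'a set set \<Rightarrow> 'a set \<Rightarrow> bool" where
  "independent_set E S \<longleftrightarrow> (\<forall>u\<in>S. \<forall>w\<in>S. {u, w} \<notin> E)"

text \<open>Only the values of a labelling on \<open>V\<close> matter in the following definitions.\<close>

definition roman_dominating :: "nat \<Rightarrow> 'a set \<Rightarrow> 'a set set \<Rightarrow> ('a \<Rightarrow> nat) \<Rightarrow> bool" where
  "roman_dominating k V E f \<longleftrightarrow>
     (\<forall>v\<in>V. f v \<le> k + 1) \<and>
     (\<forall>v\<in>V. f v < k \<longrightarrow> sum f (closed_nbhd V E v) \<ge> k + card (active_nbhd V E f v))"

definition indep_roman_number :: "nat \<Rightarrow> 'a set \<Rightarrow> 'a set set \<Rightarrow> nat" where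
  "indep_roman_number k V E =
     (LEAST w. \<exists>f. roman_dominating k V E f \<and> independent_set E {v \<in> V. f v \<ge> 1} \<and> w = sum f V)"

text \<open>The vertices of the standard copy of a snark. A link-vertex is named by the
  set \<open>A\<close> of the three indices of the vertices \<open>T i\<close> to which it is adjacent.\<close>

datatype snark_vertex =
  P nat | Q nat | R nat | S nat | T nat | U nat | V nat | Link "nat set"

definition block_verts :: "nat \<Rightarrow> snark_vertex set" where
  "block_verts i = {P i, Q i, R i, S i, T i, U i, V i}"

definition block_edges :: "nat \<Rightarrow> snark_vertex set set" where
  "block_edges i =
     {{P i, T i}, {T i, Q i}, {Q i, R i}, {R i, S i}, {S i, P i}, {U i, V i}, {U i, P i}, {V i, Q i}}"

text \<open>The choice function \<open>c\<close> selects, for each \<open>i\<close>, which of the two pairs of edges joins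
  block \<open>i\<close> to the next one.\<close>

definition junction_edges :: "nat \<Rightarrow> (nat \<Rightarrow> bool) \<Rightarrow> nat \<Rightarrow> snark_vertex set set" where
  "junction_edges l c i =
     (let j = (i + 1) mod l in
      if c i then {{S i, R j}, {V i, U j}} else {{S i, U j}, {V i, R j}})"

definition snark_verts :: "nat \<Rightarrow> nat set set \<Rightarrow> snark_vertex set" where
  "snark_verts l TT = (\<Union>i<l. block_verts i) \<union> Link ` TT"

definition snark_edges ::
  "nat \<Rightarrow> (nat \<Rightarrow> bool) \<Rightarrow> nat set set \<Rightarrow> nat set set \<Rightarrow> snark_vertex set set" where
  "snark_edges l c TT RR =
     (\<Union>i<l. block_edges i) \<union> (\<Union>i<l. junction_edges l c i)
     \<union> {{Link A, T i} | A i. A \<in> TT \<and> i \<in> A}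
     \<union> {T ` B | B. B \<in> RR}"

text \<open>Admissible choices: \<open>TT\<close> is the set of linked index triples and \<open>RR\<close> the pairing, by repairing
  edges, of the remaining indices.\<close>

definition snark_choice :: "nat \<Rightarrow> nat \<Rightarrow> nat set set \<Rightarrow> nat set set \<Rightarrow> bool" where
  "snark_choice l \<sigma> TT RR \<longleftrightarrow>
     odd l \<and> 3 \<le> l \<and> odd \<sigma> \<and> 1 \<le> \<sigma> \<and> \<sigma> \<le> l div 3 \<and>
     card TT = \<sigma> \<and> disjoint TT \<and> (\<forall>A\<in>TT. A \<subseteq> {..<l} \<and> card A = 3) \<and>
     partition_on ({..<l} - \<Union>TT) RR \<and> (\<forall>B\<in>RR. card B = 2)"

definition snark_presentation ::
  "nat \<Rightarrow> nat \<Rightarrow> (nat \<Rightarrow> bool) \<Rightarrow> nat set set \<Rightarrow> nat set set \<Rightarrow> (snark_vertex \<Rightarrow> 'a)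
    \<Rightarrow> 'a set \<Rightarrow> 'a set set \<Rightarrow> bool" where
  "snark_presentation l \<sigma> c TT RR \<phi> W E \<longleftrightarrow>
     snark_choice l \<sigma> TT RR \<and> bij_betw \<phi> (snark_verts l TT) W \<and>
     E = (\<lambda>e. \<phi> ` e) ` snark_edges l c TT RR"

definition LP1_snark :: "nat \<Rightarrow> nat \<Rightarrow> 'a set \<Rightarrow> 'a set set \<Rightarrow> bool" where
  "LP1_snark l \<sigma> W E \<longleftrightarrow> (\<exists>c TT RR \<phi>. snark_presentation l \<sigma> c TT RR \<phi> W E)"

definition LP0_snark :: "nat \<Rightarrow> nat \<Rightarrow> 'a set \<Rightarrow> 'a set set \<Rightarrow> bool" where
  "LP0_snark l \<sigma> W E \<longleftrightarrow>
     (\<exists>c TT RR \<phi>. snark_presentation l \<sigma> c TT RR \<phi> W E \<and>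
        (\<forall>A\<in>TT. \<exists>i<l. A = {i, (i + 1) mod l, (i + 2) mod l}) \<and>
        (\<forall>B\<in>RR. \<exists>i<l. B = {i, (i + 1) mod l}))"

end

theory Submission
  imports Defs
begin

text \<open>The labels of an independent \<open>[k]\<close>-Roman dominating function are \<open>0\<close>, \<open>k\<close> and \<open>k + 1\<close>, and a
  vertex labelled \<open>0\<close> has either a neighbour labelled \<open>k + 1\<close> or two neighbours labelled \<open>k\<close>. Double
  counting in a cubic graph then shows that its weight exceeds \<open>(k + 1) n / 4\<close> by at least \<open>1\<close>,
  unless there are no labels \<open>k\<close> and the vertices labelled \<open>k + 1\<close> form a perfect code, meeting every
  closed neighbourhood exactly once.

  A perfect code meets each block in \<open>{T i}\<close>, \<open>{S i, V i}\<close> or \<open>{R i, U i}\<close>, and in the last two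
  cases \<open>T i\<close> is dominated from outside the block. At a link-vertex joining three consecutive
  blocks, this forces the link-vertex into the code, hence three consecutive blocks of the last
  two kinds; but two consecutive ones must be \<open>{R i, U i}\<close> followed by \<open>{S j, V j}\<close>,
  which cannot be continued.\<close>

section \<open>Independent Roman domination in cubic graphs\<close>

text \<open>Also known as an efficient dominating set. Counting in the closed neighbourhood lets one
  equation express both independence of \<open>C\<close> and domination exactly once.\<close>

definition perfect_code :: "'a set \<Rightarrow> 'a set set \<Rightarrow> 'a set \<Rightarrow> bool" where
  "perfect_code X E C \<longleftrightarrow> C \<subseteq> X \<and> (\<forall>v\<in>X. card (closed_nbhd X E v \<inter> C) = 1)"

lemma nbhd_sym: "v \<in> X \<Longrightarrow> w \<in> nbhd X E v \<Longrightarrow> v \<in> nbhd X E w"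
  by (auto simp: nbhd_def insert_commute)

lemma nbhd_subset: "nbhd X E v \<subseteq> X"
  by (auto simp: nbhd_def)

lemma finite_nbhd: "finite X \<Longrightarrow> finite (nbhd X E v)"
  by (simp add: nbhd_def)

lemma self_notin_nbhd [simp]: "v \<notin> nbhd X E v"
  by (auto simp: nbhd_def)

text \<open>Double counting of the adjacent pairs between \<open>A\<close> and \<open>Z\<close>:
  since \<open>Z\<close> contains all neighbours of \<open>A\<close>, each vertex of
  \<open>A\<close> contributes its full degree \<open>d\<close>.\<close>

lemma sum_card_nbhd_Int:
  assumes "finite X" "A \<subseteq> X" "Z \<subseteq> X" and "\<And>v. v \<in> A \<Longrightarrow> nbhd X E v \<subseteq> Z"
    and "\<And>v. v \<in> A \<Longrightarrow> card (nbhd X E v) = d"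
  shows "(\<Sum>z\<in>Z. card (nbhd X E z \<inter> A)) = d * card A"
proof -
  have fin: "finite A" "finite Z"
    using assms finite_subset by blast+
  have "(\<Sum>z\<in>Z. card (nbhd X E z \<inter> A)) = (\<Sum>z\<in>Z. card {v\<in>A. v \<in> nbhd X E z})"
    by (intro sum.cong refl arg_cong[where f = card]) auto
  also have "\<dots> = (\<Sum>v\<in>A. card {z\<in>Z. v \<in> nbhd X E z})"
    using sum_multicount_gen[OF fin(2) fin(1), of "\<lambda>z v. v \<in> nbhd X E z"
        "\<lambda>v. card {z\<in>Z. v \<in> nbhd X E z}"] by simp
  also have "\<dots> = (\<Sum>v\<in>A. d)"
  proof (rule sum.cong[OF refl])
    fix v assume v: "v \<in> A"
    have "{z\<in>Z. v \<in> nbhd X E z} = nbhd X E v"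
      using v assms(2,3) assms(4)[OF v] nbhd_sym[of _ X] by blast
    then show "card {z\<in>Z. v \<in> nbhd X E z} = d"
      using assms(5)[OF v] by simp
  qed
  finally show ?thesis by simp
qed

text \<open>Independence forces label 0 on all neighbours of a vertex with positive label. Such a
  vertex has to meet the Roman condition by its own label, which is thus at least
  \<open>k\<close>.\<close>

lemma indep_roman_labels:
  assumes "finite X" "roman_dominating k X E f" "independent_set E {v \<in> X. f v \<ge> 1}" "v \<in> X"
  shows "f v = 0 \<or> f v = k \<or> f v = k + 1"
proof (rule ccontr)
  assume neg: "\<not> ?thesis"
  have "f v \<le> k + 1"
    using assms by (auto simp: roman_dominating_def)
  with neg have lt: "f v < k" "f v \<ge> 1" by auto
  have zero: "f w = 0" if "w \<in> nbhd X E v" for w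
    using assms(3,4) lt that by (force simp: independent_set_def nbhd_def)
  have "finite (nbhd X E v)"
    using assms(1) by (rule finite_nbhd)
  then have "sum f (closed_nbhd X E v) = f v"
    using zero by (simp add: closed_nbhd_def)
  then show False
    using assms(2,4) lt by (auto simp: roman_dominating_def)
qed

text \<open>If exactly \<open>m\<close> neighbours carry \<open>k\<close> and the others 0, the
  Roman condition reads \<open>k * m \<ge> k + m\<close>, which fails for \<open>m = 0\<close> and
  \<open>m = 1\<close>.\<close>

lemma roman_zero_nbhd:
  assumes X: "finite X" and f: "roman_dominating k X E f" and v: "v \<in> X" "f v = 0" and k: "k \<ge> 1"
    and labels: "\<And>w. w \<in> X \<Longrightarrow> f w = 0 \<or> f w = k \<or> f w = k + 1"
    and no: "nbhd X E v \<inter> {w \<in> X. f w = k + 1} = {}"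
  shows "card (nbhd X E v \<inter> {w \<in> X. f w = k}) \<ge> 2"
proof -
  let ?B = "nbhd X E v \<inter> {w \<in> X. f w = k}"
  have fin: "finite (nbhd X E v)"
    using X by (rule finite_nbhd)
  have zero: "f w = 0" if "w \<in> nbhd X E v - ?B" for w
    using that labels[of w] no nbhd_subset[of X E v] by auto
  have "sum f (closed_nbhd X E v) = sum f (nbhd X E v)"
    using v fin by (simp add: closed_nbhd_def)
  also have "\<dots> = sum f ?B"
    by (rule sum.mono_neutral_right) (use fin zero in auto)
  also have "\<dots> = k * card ?B" by simp
  finally have s: "sum f (closed_nbhd X E v) = k * card ?B" .
  have "active_nbhd X E f v = ?B"
    using zero k nbhd_subset[of X E v] by (fastforce simp: active_nbhd_def)
  with s f v k have ge: "k * card ?B \<ge> k + card ?B"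
    by (auto simp: roman_dominating_def)
  show ?thesis
  proof (rule ccontr)
    assume "\<not> ?thesis"
    then have "card ?B = 0 \<or> card ?B = 1" by linarith
    with ge k show False by auto
  qed
qed

lemma cubic_indep_roman_weight:
  assumes X: "finite X" and cubic: "\<And>v. v \<in> X \<Longrightarrow> card (nbhd X E v) = 3" and k: "k \<ge> 4"
    and f: "roman_dominating k X E f" and ind: "independent_set E {v \<in> X. f v \<ge> 1}"
    and nocode: "\<And>C. \<not> perfect_code X E C"
  shows "4 * sum f X \<ge> (k + 1) * card X + 4"
proof -
  define A where "A = {v \<in> X. f v = k + 1}"
  define B where "B = {v \<in> X. f v = k}"
  define Z where "Z = {v \<in> X. f v = 0}"
  define \<alpha> where "\<alpha> v = card (nbhd X E v \<inter> A)" for v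
  define \<beta> where "\<beta> v = card (nbhd X E v \<inter> B)" for v
  \<comment> \<open>The overdomination of a vertex labelled 0, where a neighbour labelled
    \<open>k + 1\<close> counts as two labelled \<open>k\<close> and two units are required. The
    factor 2 avoids fractions.\<close>
  define h where "h v = (int k + 1) * (2 * (int (\<alpha> v) - 1) + int (\<beta> v))" for v
  have labels: "f v = 0 \<or> f v = k \<or> f v = k + 1" if "v \<in> X" for v
    using indep_roman_labels[OF X f ind that] .
  have fin: "finite A" "finite B" "finite Z"
    using X by (auto simp: A_def B_def Z_def)
  have Xeq: "X = A \<union> B \<union> Z"
    using labels unfolding A_def B_def Z_def by blast
  have disj: "A \<inter> B = {}" "(A \<union> B) \<inter> Z = {}"
    using k by (auto simp: A_def B_def Z_def)
  have cardX: "card X = card A + card B + card Z"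
    unfolding Xeq using fin disj by (simp add: card_Un_disjoint)
  have weight: "sum f X = (k + 1) * card A + k * card B"
  proof -
    have "sum f X = sum f A + sum f B + sum f Z"
      unfolding Xeq using fin disj by (simp add: sum.union_disjoint)
    then show ?thesis by (simp add: A_def B_def Z_def)
  qed
  have nb: "nbhd X E v \<subseteq> Z" if "v \<in> A \<union> B" for v
  proof
    fix w assume w: "w \<in> nbhd X E v"
    have v: "v \<in> X" "f v \<ge> 1"
      using that k by (auto simp: A_def B_def)
    show "w \<in> Z"
      using v w ind by (force simp: Z_def nbhd_def independent_set_def)
  qed
  have sum_\<alpha>: "(\<Sum>z\<in>Z. \<alpha> z) = 3 * card A"
    unfolding \<alpha>_def using Xeq nb cubic by (intro sum_card_nbhd_Int[OF X]) auto
  have sum_\<beta>: "(\<Sum>z\<in>Z. \<beta> z) = 3 * card B"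
    unfolding \<beta>_def using Xeq nb cubic by (intro sum_card_nbhd_Int[OF X]) auto
  have dom: "\<beta> z \<ge> 2" if "z \<in> Z" "\<alpha> z = 0" for z
  proof -
    have "finite (nbhd X E z)"
      using X by (rule finite_nbhd)
    then have "nbhd X E z \<inter> A = {}"
      using that(2) by (simp add: \<alpha>_def)
    then show ?thesis
      unfolding \<beta>_def B_def using that(1) k
      by (intro roman_zero_nbhd[OF X f _ _ _ labels]) (auto simp: A_def Z_def)
  qed
  have h_nonneg: "h z \<ge> 0" if "z \<in> Z" for z
  proof -
    have "2 * (int (\<alpha> z) - 1) + int (\<beta> z) \<ge> 0"
      using dom[OF that] by (cases "\<alpha> z = 0") auto
    then show ?thesis by (simp add: h_def)
  qed
  \<comment> \<open>Since the graph is cubic, the sums of \<alpha> and \<beta> over \<open>Z\<close>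
    are three times \<open>card A\<close> and \<open>card B\<close>; the rest is algebra. Twice the
    wanted excess 4 gives the target 8 below.\<close>
  have excess: "2 * (4 * int (sum f X) - (int k + 1) * int (card X))
      = (\<Sum>z\<in>Z. h z) + int (card B) * (3 * int k - 5)"
  proof -
    have "(\<Sum>z\<in>Z. h z)
        = (int k + 1) * (2 * (int (\<Sum>z\<in>Z. \<alpha> z) - int (card Z)) + int (\<Sum>z\<in>Z. \<beta> z))"
      by (simp add: h_def sum_distrib_left[symmetric] sum.distrib sum_subtractf)
    then show ?thesis
      unfolding sum_\<alpha> sum_\<beta> weight cardX by (simp add: algebra_simps)
  qed
  have "(\<Sum>z\<in>Z. h z) + int (card B) * (3 * int k - 5) \<ge> 8"
  proof -
    consider "card B = 0" | "card B = 1" | "card B \<ge> 2" by linarith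
    then show ?thesis
    proof cases
      case 1
      then have B: "B = {}" using fin by simp
      \<comment> \<open>Without labels \<open>k\<close>, having \<alpha> equal to 1 on all of
        \<open>Z\<close> would make \<open>A\<close> a perfect code.\<close>
      have "\<exists>z\<in>Z. \<alpha> z \<noteq> 1"
      proof (rule ccontr)
        assume "\<not> ?thesis"
        then have \<alpha>1: "\<alpha> z = 1" if "z \<in> Z" for z using that by auto
        have "card (closed_nbhd X E v \<inter> A) = 1" if "v \<in> X" for v
        proof (cases "v \<in> A")
          case True
          then have "closed_nbhd X E v \<inter> A = {v}"
            using nb[of v] disj by (auto simp: closed_nbhd_def)
          then show ?thesis by simp
        next
          case False
          then have "v \<in> Z" "closed_nbhd X E v \<inter> A = nbhd X E v \<inter> A"
            using that Xeq B by (auto simp: closed_nbhd_def)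
          then show ?thesis using \<alpha>1 by (simp add: \<alpha>_def)
        qed
        then have "perfect_code X E A"
          using Xeq by (auto simp: perfect_code_def)
        with nocode show False by blast
      qed
      then obtain z where z: "z \<in> Z" "\<alpha> z \<noteq> 1" by blast
      have "\<beta> z = 0" using B by (simp add: \<beta>_def)
      with dom[OF z(1)] z(2) have "\<alpha> z \<ge> 2" by linarith
      then have "h z \<ge> (int k + 1) * 2"
        unfolding h_def by (intro mult_left_mono) auto
      moreover have "h z \<le> (\<Sum>z\<in>Z. h z)"
        using z h_nonneg fin by (intro member_le_sum) auto
      ultimately show ?thesis using 1 k by auto
    next
      case 2
      then obtain b where B: "B = {b}" by (auto simp: card_1_singleton_iff)
      have bX: "b \<in> X" using B Xeq by auto
      with cubic[of b] obtain z where z: "z \<in> nbhd X E b"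
        by (metis card.empty ex_in_conv zero_neq_numeral)
      then have zZ: "z \<in> Z" using nb[of b] B by auto
      have "nbhd X E z \<inter> B = {b}"
        using nbhd_sym[OF bX z] B by auto
      \<comment> \<open>A single neighbour labelled \<open>k\<close> does not dominate
        \<open>z\<close>, so \<open>z\<close> also has one labelled \<open>k + 1\<close> and is
        overdominated. The total is at least \<open>(k + 1) + (3 * k - 5)\<close>, hence at least
        12.\<close>
      then have \<beta>: "\<beta> z = 1" by (simp add: \<beta>_def)
      with dom[OF zZ] have "\<alpha> z \<ge> 1" by linarith
      with \<beta> have "h z \<ge> (int k + 1) * 1"
        unfolding h_def by (intro mult_left_mono) auto
      moreover have "h z \<le> (\<Sum>z\<in>Z. h z)"
        using zZ h_nonneg fin by (intro member_le_sum) auto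
      ultimately show ?thesis using 2 k by auto
    next
      case 3
      have "int (card B) * (3 * int k - 5) \<ge> 2 * 7"
        using 3 k by (intro mult_mono) auto
      moreover have "(\<Sum>z\<in>Z. h z) \<ge> 0"
        using h_nonneg by (intro sum_nonneg) auto
      ultimately show ?thesis by linarith
    qed
  qed
  moreover have "4 * int (sum f X) - (int k + 1) * int (card X)
      = int (4 * sum f X) - int ((k + 1) * card X)"
    by (simp add: algebra_simps)
  ultimately have "int (4 * sum f X) - int ((k + 1) * card X) \<ge> 4"
    using excess by presburger
  then show ?thesis by linarith
qed

text \<open>A maximal independent set is dominating, so label \<open>k + 1\<close> on it and 0
  elsewhere works. This ensures that the \<open>LEAST\<close> in \<open>indep_roman_number\<close>
  is attained.\<close>

lemma indep_roman_function_exists: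
  assumes X: "finite X" and loopfree: "\<And>v. {v} \<notin> E"
  shows "\<exists>f. roman_dominating k X E f \<and> independent_set E {v \<in> X. f v \<ge> 1}"
proof -
  let ?I = "{C. C \<subseteq> X \<and> independent_set E C}"
  have "{} \<in> ?I" by (simp add: independent_set_def)
  then have "\<exists>C\<in>?I. \<forall>D\<in>?I. C \<subseteq> D \<longrightarrow> C = D"
    using X by (intro finite_has_maximal) auto
  then obtain C where C: "C \<in> ?I" and max: "\<forall>D\<in>?I. C \<subseteq> D \<longrightarrow> C = D"
    by (rule bexE)
  define f where "f v = (if v \<in> C then k + 1 else 0)" for v
  have pos: "{v \<in> X. f v \<ge> 1} = C"
    using C by (auto simp: f_def)
  have dom: "sum f (closed_nbhd X E v) \<ge> k + card (active_nbhd X E f v)"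
    if v: "v \<in> X" "f v < k" for v
  proof -
    have vC: "v \<notin> C" using v by (auto simp: f_def)
    have "insert v C \<notin> ?I"
    proof
      assume "insert v C \<in> ?I"
      from bspec[OF max this] vC show False by auto
    qed
    \<comment> \<open>Independence of \<open>insert v C\<close> could also fail through a loop at
      \<open>v\<close>; \<open>loopfree\<close> excludes that.\<close>
    then obtain w where w: "w \<in> C" "{v, w} \<in> E"
      using C v loopfree by (fastforce simp: independent_set_def insert_commute)
    have fin: "finite (nbhd X E v)"
      using X by (rule finite_nbhd)
    have act: "active_nbhd X E f v = nbhd X E v \<inter> C"
      by (auto simp: active_nbhd_def f_def)
    have "w \<in> nbhd X E v \<inter> C"
      using w vC C by (auto simp: nbhd_def)
    then have m: "card (nbhd X E v \<inter> C) \<ge> 1"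
      using fin by (metis One_nat_def Suc_leI card_gt_0_iff empty_iff finite_Int)
    have "sum f (closed_nbhd X E v) = sum f (nbhd X E v)"
      using vC fin by (simp add: closed_nbhd_def f_def)
    also have "\<dots> = (\<Sum>w\<in>nbhd X E v \<inter> C. k + 1)"
      unfolding f_def using fin by (simp add: sum.If_cases Int_def)
    also have "\<dots> = k * card (nbhd X E v \<inter> C) + card (nbhd X E v \<inter> C)"
      by (simp add: algebra_simps)
    also have "\<dots> \<ge> k * 1 + card (nbhd X E v \<inter> C)"
      using m by (intro add_mono mult_left_mono) auto
    finally show ?thesis by (simp add: act)
  qed
  have "roman_dominating k X E f"
    unfolding roman_dominating_def using dom by (auto simp: f_def)
  moreover have "independent_set E {v \<in> X. f v \<ge> 1}"
    using C pos by simp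
  ultimately show ?thesis by blast
qed

lemma cubic_indep_roman_number:
  assumes "finite X" "\<And>v. {v} \<notin> E" "\<And>v. v \<in> X \<Longrightarrow> card (nbhd X E v) = 3" "k \<ge> 4"
    "\<And>C. \<not> perfect_code X E C"
  shows "4 * indep_roman_number k X E \<ge> (k + 1) * card X + 4"
proof -
  let ?P = "\<lambda>w. \<exists>f. roman_dominating k X E f \<and> independent_set E {v \<in> X. f v \<ge> 1} \<and> w = sum f X"
  have "\<exists>w. ?P w"
    using indep_roman_function_exists[OF assms(1,2)] by blast
  then have "?P (indep_roman_number k X E)"
    unfolding indep_roman_number_def by (rule LeastI_ex)
  then show ?thesis
    using cubic_indep_roman_weight[OF assms(1,3,4) _ _ assms(5)] by auto
qed

section \<open>Isomorphic copies\<close>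

text \<open>As \<phi> is injective only on \<open>X\<close>, an image edge has a unique preimage
  because all edges lie inside \<open>X\<close>.\<close>

lemma nbhd_image:
  assumes inj: "inj_on \<phi> X" and sub: "\<And>e. e \<in> E \<Longrightarrow> e \<subseteq> X" and v: "v \<in> X"
  shows "nbhd (\<phi> ` X) ((`) \<phi> ` E) (\<phi> v) = \<phi> ` nbhd X E v"
proof -
  have "{\<phi> v, \<phi> w} \<in> (`) \<phi> ` E \<longleftrightarrow> {v, w} \<in> E" if "w \<in> X" for w
  proof
    assume "{\<phi> v, \<phi> w} \<in> (`) \<phi> ` E"
    then obtain e where e: "e \<in> E" "\<phi> ` {v, w} = \<phi> ` e" by auto
    then have "{v, w} = e"
      using inj_on_image_eq_iff[OF inj, of "{v, w}" e] sub v that by auto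
    with e show "{v, w} \<in> E" by simp
  next
    assume "{v, w} \<in> E"
    then show "{\<phi> v, \<phi> w} \<in> (`) \<phi> ` E" by (auto intro!: image_eqI[where x = "{v, w}"])
  qed
  then show ?thesis
    using inj v by (auto simp: nbhd_def inj_on_eq_iff)
qed

text \<open>Pulling a code back along \<phi> reduces the exclusion of perfect codes to the standard
  copy.\<close>

lemma perfect_code_image:
  assumes inj: "inj_on \<phi> X" and sub: "\<And>e. e \<in> E \<Longrightarrow> e \<subseteq> X"
    and C: "perfect_code (\<phi> ` X) ((`) \<phi> ` E) C"
  shows "perfect_code X E {v \<in> X. \<phi> v \<in> C}"
proof -
  have "card (closed_nbhd X E v \<inter> {v \<in> X. \<phi> v \<in> C}) = 1" if v: "v \<in> X" for v
  proof -
    let ?D = "closed_nbhd X E v \<inter> {v \<in> X. \<phi> v \<in> C}"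
    have nb: "nbhd (\<phi> ` X) ((`) \<phi> ` E) (\<phi> v) = \<phi> ` nbhd X E v"
      using nbhd_image[OF inj _ v] sub by blast
    have "closed_nbhd (\<phi> ` X) ((`) \<phi> ` E) (\<phi> v) \<inter> C = \<phi> ` ?D"
      unfolding closed_nbhd_def nb using v nbhd_subset[of X E v] by auto
    moreover have "card (\<phi> ` ?D) = card ?D"
      by (rule card_image, rule inj_on_subset[OF inj]) auto
    ultimately show ?thesis
      using C v by (auto simp: perfect_code_def)
  qed
  then show ?thesis by (auto simp: perfect_code_def)
qed

section \<open>The standard copy of a snark\<close>

lemma Suc_mod_inj: "i < l \<Longrightarrow> i' < l \<Longrightarrow> Suc i mod l = Suc i' mod l \<longleftrightarrow> i = i'"
  by (auto simp: mod_Suc split: if_splits)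

locale standard_snark =
  fixes l \<sigma> :: nat and c :: "nat \<Rightarrow> bool" and TT RR :: "nat set set"
  assumes choice: "snark_choice l \<sigma> TT RR"
begin

abbreviation "X \<equiv> snark_verts l TT"
abbreviation "E \<equiv> snark_edges l c TT RR"
abbreviation "nx i \<equiv> Suc i mod l"

section \<open>Indices, vertices and edges\<close>

lemma l_ge: "3 \<le> l"
  using choice by (simp add: snark_choice_def)

lemma nx_less: "nx i < l"
  using l_ge by simp

lemma nx_neq: "i < l \<Longrightarrow> nx i \<noteq> i"
  using l_ge by (simp add: mod_Suc)

text \<open>The third neighbours of \<open>R\<close> and \<open>U\<close> depend on the choice made
  at the preceding block, so their neighbourhoods are stated at index \<open>nx i\<close>; this
  brings any index into that form.\<close>

lemma nx_surj: assumes "j < l" obtains i where "i < l" "j = nx i"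
proof (cases j)
  case 0
  then show ?thesis using that[of "l - 1"] l_ge by simp
next
  case (Suc i)
  then show ?thesis using that[of i] assms by simp
qed

lemma triple: "A \<in> TT \<Longrightarrow> A \<subseteq> {..<l} \<and> card A = 3"
  using choice by (simp add: snark_choice_def)

lemma triple_unique: "A \<in> TT \<Longrightarrow> A' \<in> TT \<Longrightarrow> i \<in> A \<Longrightarrow> i \<in> A' \<Longrightarrow> A = A'"
  using choice unfolding snark_choice_def disjoint_def by blast

lemma pair_unique: "B \<in> RR \<Longrightarrow> B' \<in> RR \<Longrightarrow> i \<in> B \<Longrightarrow> i \<in> B' \<Longrightarrow> B = B'"
  using choice unfolding snark_choice_def partition_on_def disjoint_def by blast

lemma Union_RR: "\<Union>RR = {..<l} - \<Union>TT"
  using choice by (simp add: snark_choice_def partition_on_def)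

lemma card_RR: "B \<in> RR \<Longrightarrow> card B = 2"
  using choice by (simp add: snark_choice_def)

lemma finite_TT: "finite TT"
  \<comment> \<open>An infinite set has \<open>card\<close> 0, whereas \<open>card TT\<close> is
    \<sigma>, which is at least 1.\<close>
  using choice card.infinite by (fastforce simp: snark_choice_def)

lemma finite_X: "finite X"
  using finite_TT by (simp add: snark_verts_def block_verts_def)

lemma in_X [simp]:
  "P i \<in> X \<longleftrightarrow> i < l" "Q i \<in> X \<longleftrightarrow> i < l" "R i \<in> X \<longleftrightarrow> i < l" "S i \<in> X \<longleftrightarrow> i < l"
  "T i \<in> X \<longleftrightarrow> i < l" "U i \<in> X \<longleftrightarrow> i < l" "V i \<in> X \<longleftrightarrow> i < l" "Link A \<in> X \<longleftrightarrow> A \<in> TT"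
  by (auto simp: snark_verts_def block_verts_def)

lemma card_X: "card X = 7 * l + \<sigma>"
proof -
  have "card (block_verts i) = 7" for i by (simp add: block_verts_def)
  then have "card (\<Union>i<l. block_verts i) = 7 * l"
    by (subst card_UN_disjoint) (auto simp: block_verts_def)
  moreover have "card (Link ` TT) = \<sigma>"
    using choice by (subst card_image) (auto simp: inj_on_def snark_choice_def)
  moreover have "(\<Union>i<l. block_verts i) \<inter> Link ` TT = {}"
    by (auto simp: block_verts_def)
  ultimately show ?thesis
    unfolding snark_verts_def using finite_TT
    by (subst card_Un_disjoint) (auto simp: block_verts_def)
qed

lemma edge_iff:
  "e \<in> E \<longleftrightarrow> (\<exists>i<l. e \<in> block_edges i) \<or> (\<exists>i<l. e \<in> junction_edges l c i)
     \<or> (\<exists>A\<in>TT. \<exists>i\<in>A. e = {Link A, T i}) \<or> (\<exists>B\<in>RR. e = T ` B)"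
  by (auto simp: snark_edges_def)

lemma edge_card: "e \<in> E \<Longrightarrow> card e = 2"
  using card_RR
  by (auto simp: edge_iff block_edges_def junction_edges_def Let_def card_image inj_on_def
      split: if_splits)

lemma edge_subset: "e \<in> E \<Longrightarrow> e \<subseteq> X"
  using triple Union_RR nx_less
  by (fastforce simp: edge_iff block_edges_def junction_edges_def Let_def split: if_splits)

text \<open>The side conditions in \<open>nbhd\<close> are automatic: edges have two elements and
  lie in \<open>X\<close>. Neighbourhoods can then be read off from the edge list.\<close>

lemma nbhd_iff: "w \<in> nbhd X E v \<longleftrightarrow> {v, w} \<in> E"
proof
  assume e: "{v, w} \<in> E"
  then show "w \<in> nbhd X E v"
    using edge_card[OF e] edge_subset[OF e] by (auto simp: nbhd_def)
qed (auto simp: nbhd_def)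

lemma T_pair_image: "{T i, w} = T ` B \<longleftrightarrow> (\<exists>j. w = T j \<and> B = {i, j})"
  by (auto simp: image_def set_eq_iff) blast+

lemmas edge_simps = edge_iff block_edges_def junction_edges_def Let_def doubleton_eq_iff

section \<open>Neighbourhoods and 3-regularity\<close>

lemma nbhd_P: "i < l \<Longrightarrow> nbhd X E (P i) = {T i, S i, U i}"
  by (auto simp: nbhd_iff edge_simps split: if_splits)

lemma nbhd_Q: "i < l \<Longrightarrow> nbhd X E (Q i) = {T i, R i, V i}"
  by (auto simp: nbhd_iff edge_simps split: if_splits)

lemma nbhd_S: "i < l \<Longrightarrow> nbhd X E (S i) = {P i, R i, if c i then R (nx i) else U (nx i)}"
  by (auto simp: nbhd_iff edge_simps split: if_splits)

lemma nbhd_V: "i < l \<Longrightarrow> nbhd X E (V i) = {Q i, U i, if c i then U (nx i) else R (nx i)}"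
  by (auto simp: nbhd_iff edge_simps split: if_splits)

lemma nbhd_R: "i < l \<Longrightarrow> nbhd X E (R (nx i)) = {Q (nx i), S (nx i), if c i then S i else V i}"
  using nx_less by (auto simp: nbhd_iff edge_simps Suc_mod_inj split: if_splits)

lemma nbhd_U: "i < l \<Longrightarrow> nbhd X E (U (nx i)) = {P (nx i), V (nx i), if c i then V i else S i}"
  using nx_less by (auto simp: nbhd_iff edge_simps Suc_mod_inj split: if_splits)

lemma nbhd_Link: "A \<in> TT \<Longrightarrow> nbhd X E (Link A) = T ` A"
  by (auto simp: nbhd_iff edge_simps split: if_splits)

lemma T_edge_iff: "{T i, w} \<in> E \<longleftrightarrow>
    i < l \<and> (w = P i \<or> w = Q i) \<or> (\<exists>A\<in>TT. i \<in> A \<and> w = Link A) \<or> (\<exists>j. w = T j \<and> {i, j} \<in> RR)"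
  by (auto simp: edge_simps T_pair_image split: if_splits)

lemma nbhd_T_linked:
  assumes A: "A \<in> TT" "i \<in> A"
  shows "nbhd X E (T i) = {P i, Q i, Link A}"
proof -
  have "i < l" using triple[OF A(1)] A(2) by auto
  moreover have "{i, j} \<notin> RR" for j using Union_RR A by blast
  moreover have "(\<exists>A'\<in>TT. i \<in> A' \<and> w = Link A') \<longleftrightarrow> w = Link A" for w
    using triple_unique[OF _ A(1) _ A(2)] A by blast
  ultimately show ?thesis using A by (auto simp: nbhd_iff T_edge_iff)
qed

lemma nbhd_T_repaired:
  assumes B: "{i, j} \<in> RR"
  shows "nbhd X E (T i) = {P i, Q i, T j}"
proof -
  have "i \<in> {..<l} - \<Union>TT" using Union_RR B by blast
  moreover have "j' = j" if "{i, j'} \<in> RR" for j'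
    using pair_unique[OF that B, of i] by (auto simp: doubleton_eq_iff)
  then have "(\<exists>j'. w = T j' \<and> {i, j'} \<in> RR) \<longleftrightarrow> w = T j" for w
    using B by blast
  ultimately show ?thesis using B by (auto simp: nbhd_iff T_edge_iff)
qed

lemma cubic: assumes "v \<in> X" shows "card (nbhd X E v) = 3"
proof (cases v)
  case (T i)
  then have i: "i < l" using assms by simp
  show ?thesis
  proof (cases "i \<in> \<Union>TT")
    case True
    then show ?thesis using T nbhd_T_linked by auto
  next
    case False
    then obtain B where B: "B \<in> RR" "i \<in> B" using Union_RR i by blast
    then obtain j where "B = {i, j}" "i \<noteq> j"
      using card_RR[of B] by (auto simp: card_2_iff)
    then show ?thesis using T B nbhd_T_repaired[of i j] by simp
  qed
next
  case (R j)
  then obtain i where "i < l" "j = nx i" using assms nx_surj[of j] by auto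
  \<comment> \<open>The neighbour in block \<open>i\<close> differs from \<open>S (nx i)\<close>
    because \<open>nx i \<noteq> i\<close>.\<close>
  then show ?thesis using R nx_neq[of i] by (simp add: nbhd_R)
next
  case (U j)
  then obtain i where "i < l" "j = nx i" using assms nx_surj[of j] by auto
  then show ?thesis using U nx_neq[of i] by (simp add: nbhd_U)
next
  case (Link A)
  then show ?thesis using assms triple[of A] by (simp add: nbhd_Link card_image inj_on_def)
qed (use assms nx_neq nx_neq[THEN not_sym] in \<open>auto simp: nbhd_P nbhd_Q nbhd_S nbhd_V\<close>)

section \<open>Perfect codes in a snark\<close>

lemma perfect_code_dominates:
  assumes "perfect_code X E C" "v \<in> X"
  shows "\<exists>w\<in>insert v (nbhd X E v). w \<in> C"
proof -
  have "card (insert v (nbhd X E v) \<inter> C) = 1"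
    using assms by (simp add: perfect_code_def closed_nbhd_def)
  then have "insert v (nbhd X E v) \<inter> C \<noteq> {}" by force
  then show ?thesis by blast
qed

lemma perfect_code_unique:
  assumes C: "perfect_code X E C" and e: "{v, w} \<in> E" "w \<in> C"
  shows "v \<notin> C" and "{v, w'} \<in> E \<Longrightarrow> w' \<in> C \<Longrightarrow> w' = w"
proof -
  have "v \<in> X" using edge_subset[OF e(1)] by simp
  then have "card (insert v (nbhd X E v) \<inter> C) = 1"
    using C by (simp add: perfect_code_def closed_nbhd_def)
  then obtain x where x: "insert v (nbhd X E v) \<inter> C = {x}"
    by (auto simp: card_1_singleton_iff)
  have "w \<in> nbhd X E v" using e(1) by (simp add: nbhd_iff)
  with e(2) x have "w = x" by blast
  show "v \<notin> C"
  proof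
    assume "v \<in> C"
    then have "v = w" using x \<open>w = x\<close> by blast
    then show False using \<open>w \<in> nbhd X E v\<close> by simp
  qed
  show "w' = w" if "{v, w'} \<in> E" "w' \<in> C"
    using that x \<open>w = x\<close> nbhd_iff[of w' v] by blast
qed

lemma block_edges_subset: "i < l \<Longrightarrow> e \<in> block_edges i \<Longrightarrow> e \<in> E"
  by (auto simp: edge_iff)

text \<open>Both orientations are listed because \<open>perfect_code_unique\<close> is applied to a
  pair whose first entry is the vertex whose closed neighbourhood is considered.\<close>

lemma block_edge:
  assumes "i < l"
  shows "{P i, T i} \<in> E" "{T i, P i} \<in> E" "{P i, S i} \<in> E" "{S i, P i} \<in> E" "{P i, U i} \<in> E"
    "{U i, P i} \<in> E" "{Q i, T i} \<in> E" "{T i, Q i} \<in> E" "{Q i, R i} \<in> E" "{R i, Q i} \<in> E"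
    "{Q i, V i} \<in> E" "{V i, Q i} \<in> E" "{R i, S i} \<in> E" "{S i, R i} \<in> E" "{U i, V i} \<in> E"
    "{V i, U i} \<in> E"
  by (rule block_edges_subset[OF assms], simp add: block_edges_def doubleton_eq_iff)+

text \<open>With \<open>T i\<close> outside the code, \<open>P i\<close> and \<open>Q i\<close> must
  be dominated by themselves or by their other neighbours. Code vertices are neither adjacent nor
  share a neighbour, which leaves only the two stated options.\<close>

lemma perfect_code_block:
  assumes C: "perfect_code X E C" and i: "i < l" and t: "T i \<notin> C"
  shows "P i \<notin> C" "Q i \<notin> C" "S i \<in> C \<and> V i \<in> C \<or> R i \<in> C \<and> U i \<in> C"
proof -
  have P: "P i \<in> C \<or> S i \<in> C \<or> U i \<in> C"
    using perfect_code_dominates[OF C, of "P i"] i t by (auto simp: nbhd_P)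
  have Q: "Q i \<in> C \<or> R i \<in> C \<or> V i \<in> C"
    using perfect_code_dominates[OF C, of "Q i"] i t by (auto simp: nbhd_Q)
  have one: "\<not> (w \<in> C \<and> w' \<in> C)" if "{v, w} \<in> E" "{v, w'} \<in> E" "w \<noteq> w'" for v w w'
    using perfect_code_unique(2)[OF C that(1) _ that(2)] that(3) by blast
  note e = block_edge[OF i]
  \<comment> \<open>In this and the next five facts, the vertex given to \<open>one\<close> is a
    common neighbour of the two.\<close>
  have PQ: "\<not> (P i \<in> C \<and> Q i \<in> C)" by (rule one[of "T i"]) (use e in auto)
  have PR: "\<not> (P i \<in> C \<and> R i \<in> C)" by (rule one[of "S i"]) (use e in auto)
  have PV: "\<not> (P i \<in> C \<and> V i \<in> C)" by (rule one[of "U i"]) (use e in auto)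
  have QS: "\<not> (Q i \<in> C \<and> S i \<in> C)" by (rule one[of "R i"]) (use e in auto)
  have QU: "\<not> (Q i \<in> C \<and> U i \<in> C)" by (rule one[of "V i"]) (use e in auto)
  have SU: "\<not> (S i \<in> C \<and> U i \<in> C)" by (rule one[of "P i"]) (use e in auto)
  have RS: "S i \<in> C \<Longrightarrow> R i \<notin> C" by (rule perfect_code_unique(1)[OF C]) (use e in auto)
  have UV: "V i \<in> C \<Longrightarrow> U i \<notin> C" by (rule perfect_code_unique(1)[OF C]) (use e in auto)
  show "P i \<notin> C" using Q PQ PR PV by blast
  moreover show "Q i \<notin> C" using P PQ QS QU by blast
  ultimately show "S i \<in> C \<and> V i \<in> C \<or> R i \<in> C \<and> U i \<in> C" using P Q SU RS UV by blast
qed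

text \<open>For either value of \<open>c i\<close>, \<open>S i\<close> is joined to
  \<open>R (nx i)\<close> or \<open>U (nx i)\<close>, and \<open>R (nx i)\<close> to
  \<open>S i\<close> or \<open>V i\<close>. Hence every combination of block patterns but one gives
  \<open>S i\<close> or \<open>R (nx i)\<close> two code neighbours.\<close>

lemma perfect_code_consecutive:
  assumes C: "perfect_code X E C" and i: "i < l" and t: "T i \<notin> C" "T (nx i) \<notin> C"
  shows "R i \<in> C" "S (nx i) \<in> C"
proof -
  note one = perfect_code_unique[OF C]
  note e = block_edge[OF i] block_edge[OF nx_less[of i]]
  have out: "{S i, if c i then R (nx i) else U (nx i)} \<in> E"
    "{R (nx i), if c i then S i else V i} \<in> E"
    using nbhd_S[OF i] nbhd_R[OF i] by (simp_all flip: nbhd_iff)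
  have b: "S i \<in> C \<and> V i \<in> C \<or> R i \<in> C \<and> U i \<in> C"
    "S (nx i) \<in> C \<and> V (nx i) \<in> C \<or> R (nx i) \<in> C \<and> U (nx i) \<in> C"
    using perfect_code_block(3)[OF C] i t nx_less by auto
  have nxRU: "\<not> (R (nx i) \<in> C \<and> U (nx i) \<in> C)"
  proof
    assume n: "R (nx i) \<in> C \<and> U (nx i) \<in> C"
    have "S i \<notin> C"
      by (rule one(1)[OF out(1)]) (use n in auto)
    then have "R i \<in> C" using b by blast
    \<comment> \<open>Both sides are code neighbours of \<open>S i\<close>, so they coincide,
      although they lie in different blocks.\<close>
    then have "(if c i then R (nx i) else U (nx i)) = R i"
      using one(2)[OF e(14) _ out(1)] n by simp
    then show False using nx_neq[OF i] by (auto split: if_splits)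
  qed
  then show Sn: "S (nx i) \<in> C" using b by blast
  show "R i \<in> C"
  proof (rule ccontr)
    assume "R i \<notin> C"
    then have n: "S i \<in> C" "V i \<in> C" using b by auto
    \<comment> \<open>Here the two code neighbours belong to \<open>R (nx i)\<close>.\<close>
    have "(if c i then S i else V i) = S (nx i)"
      by (rule one(2)[OF _ Sn out(2)]) (use e n in auto)
    then show False using nx_neq[OF i] by (auto split: if_splits)
  qed
qed

lemma no_perfect_code:
  assumes LP0: "\<forall>A\<in>TT. \<exists>i<l. A = {i, (i + 1) mod l, (i + 2) mod l}"
  shows "\<not> perfect_code X E C"
proof
  assume C: "perfect_code X E C"
  have "TT \<noteq> {}"
    using choice by (auto simp: snark_choice_def)
  then obtain A where A: "A \<in> TT" by blast
  with LP0 obtain i where i: "i < l" "A = {i, nx i, nx (nx i)}"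
    by (auto simp: mod_Suc_eq)
  have link: "{Link A, T j} \<in> E" "{T j, Link A} \<in> E" if "j \<in> A" for j
    using A that by (auto simp: edge_iff insert_commute)
  \<comment> \<open>Otherwise each \<open>T j\<close> with \<open>j \<in> A\<close> is itself in the
    code, since \<open>P j\<close> and \<open>Q j\<close> are not, and \<open>Link A\<close> gets
    several code neighbours.\<close>
  have "Link A \<in> C"
  proof (rule ccontr)
    assume L: "Link A \<notin> C"
    have tC: "T j \<in> C" if "j \<in> A" for j
    proof (rule ccontr)
      assume t: "T j \<notin> C"
      have j: "j < l" using triple[OF A] that by auto
      show False
        using perfect_code_dominates[OF C, of "T j"] perfect_code_block(1,2)[OF C j t] t L j
        by (auto simp: nbhd_T_linked[OF A that])
    qed
    have "T (nx i) = T i"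
      using i by (intro perfect_code_unique(2)[OF C link(1)] link(1) tC) auto
    then show False using nx_neq[OF i(1)] by simp
  qed
  then have t: "T j \<notin> C" if "j \<in> A" for j
    using perfect_code_unique(1)[OF C link(2)[OF that]] by blast
  \<comment> \<open>The middle block is second in one consecutive pair and first in the next, so the
    adjacent vertices \<open>S (nx i)\<close> and \<open>R (nx i)\<close> are both in the
    code.\<close>
  have "S (nx i) \<in> C"
    using perfect_code_consecutive(2)[OF C i(1)] t i by simp
  moreover have "R (nx i) \<in> C"
    using perfect_code_consecutive(1)[OF C nx_less, of i] t i by simp
  ultimately show False
    using perfect_code_unique(1)[OF C block_edge(13)[OF nx_less]] by blast
qed

end

theorem theorem5p5:
  fixes k l \<sigma> n :: nat and W :: "'a set" and E :: "'a set set"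
  assumes "k \<ge> 4" and "l \<ge> 3" and "LP0_snark l \<sigma> W E" and "n = card W"
  shows "n = 7 * l + \<sigma> \<and>
         int (indep_roman_number k W E) \<ge> \<lceil>real ((k + 1) * n) / 4\<rceil> + 1"
proof -
  obtain c TT RR \<phi> where pres: "snark_presentation l \<sigma> c TT RR \<phi> W E"
    and LP0: "\<forall>A\<in>TT. \<exists>i<l. A = {i, (i + 1) mod l, (i + 2) mod l}"
    using assms(3) unfolding LP0_snark_def by (elim exE conjE) (rule that)
  interpret standard_snark l \<sigma> c TT RR
    using pres by unfold_locales (simp add: snark_presentation_def)
  let ?X = "snark_verts l TT" and ?E = "snark_edges l c TT RR"
  have inj: "inj_on \<phi> ?X" and W: "W = \<phi> ` ?X" and E: "E = (`) \<phi> ` ?E"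
    using pres by (auto simp: snark_presentation_def bij_betw_def)
  have cardW: "card W = 7 * l + \<sigma>"
    using card_X inj W by (simp add: card_image)
  have "card (nbhd W E v) = 3" if v: "v \<in> W" for v
  proof -
    obtain x where x: "x \<in> ?X" "v = \<phi> x" using v W by auto
    have "nbhd W E v = \<phi> ` nbhd ?X ?E x"
      unfolding W E x(2) by (rule nbhd_image[OF inj _ x(1)]) (rule edge_subset)
    then show ?thesis
      using cubic[OF x(1)] inj_on_subset[OF inj nbhd_subset] by (simp add: card_image)
  qed
  moreover have "{v} \<notin> E" for v
  proof
    assume "{v} \<in> E"
    then obtain e where e: "e \<in> ?E" "\<phi> ` e = {v}" using E by auto
    then have "card e = 1"
      using card_image[OF inj_on_subset[OF inj edge_subset[OF e(1)]]] by simp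
    then show False using edge_card[OF e(1)] by simp
  qed
  moreover have "\<not> perfect_code W E C" for C
  proof
    assume "perfect_code W E C"
    then have "perfect_code ?X ?E {v \<in> ?X. \<phi> v \<in> C}"
      unfolding W E by (rule perfect_code_image[OF inj, rotated]) (rule edge_subset)
    then show False using no_perfect_code[OF LP0] by blast
  qed
  ultimately have bound: "4 * indep_roman_number k W E \<ge> (k + 1) * card W + 4"
    using finite_X W assms(1) by (intro cubic_indep_roman_number) auto
  \<comment> \<open>The bound is put as \<open>int a - 1\<close>, an integer above
    \<open>m / 4\<close>, so that it also bounds the ceiling.\<close>
  have "real m / 4 \<le> real_of_int (int a - 1)" if "4 * a \<ge> m + 4" for m a :: nat
    using that by linarith
  from this[OF bound] have "real ((k + 1) * n) / 4 \<le> real_of_int (int (indep_roman_number k W E) - 1)"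
    unfolding assms(4) .
  then have "\<lceil>real ((k + 1) * n) / 4\<rceil> \<le> int (indep_roman_number k W E) - 1"
    by (simp only: ceiling_le_iff)
  then show ?thesis using cardW assms(4) by simp
qed

end
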